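(* Let $-\infty<a<b<\infty$ and let $X$ be a real-valued random variable with $\mathbb{P}(X\in[a,b])=1$. Let $\{\varepsilon_n\}_{n\ge 0}$ be the primitive sequence associated with the law of $X$. Then $$\varepsilon_n=\frac{1}{n!}\,\mathbb{E}\left[(b-X)^n\right],\qquad n\ge 0.$$
   Context: Let $F_X(x)=\mathbb{P}(X\le x)$, $x\in\mathbb{R}$, be the cdf of $X$. Define $F_X^{(0)}:=F_X$ and recursively $F_X^{(-n)}(t):=\int_a^t F_X^{(-(n-1))}(x)\,dx$ for $n\ge 1$. The primitive sequence associated with the law of $X$ is $\varepsilon_n:=F_X^{(-n)}(b)$, $n\ge 0$. No continuity or full-support assumption is made on $X$. Convention: $0^0=1$. *)

theory Defs
  imports "HOL-Probability.Probability"
begin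

(* iterated_cdf \<mu> a n is F^(-n), where F is the cdf of the law \<mu>. For t < a the integral is the
   oriented one, as in the usual convention for an integral from a to t. *)
primrec iterated_cdf :: "real measure \<Rightarrow> real \<Rightarrow> nat \<Rightarrow> real \<Rightarrow> real" where
  "iterated_cdf \<mu> a 0 = cdf \<mu>"
| "iterated_cdf \<mu> a (Suc n) = (\<lambda>t. LBINT x=ereal a..ereal t. iterated_cdf \<mu> a n x)"

definition primitive_seq :: "real measure \<Rightarrow> real \<Rightarrow> real \<Rightarrow> nat \<Rightarrow> real" where
  "primitive_seq \<mu> a b n = iterated_cdf \<mu> a n b"

end

theory Submission
  imports Defs
begin

text \<open>
  For a law carried by the half-line from \<open>a\<close> on, the \<open>n\<close>-th iterated primitive of the cdf is the
  truncated moment \<open>E[(t - X)^n; X \<le> t] / n!\<close>: integrating over \<open>t\<close> and exchanging the integrals by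
  Fubini raises \<open>n\<close> by one. At \<open>t = b\<close> the truncation is almost surely void.
\<close>

lemma integral_shifted_power:
  fixes x t :: real
  assumes "x \<le> t"
  shows "(LINT s|lborel. indicator {x..t} s * (s - x) ^ n) = (t - x) ^ Suc n / real (Suc n)"
proof -
  have "(LINT s|lborel. (s - x) ^ n * indicator {x..t} s)
      = (t - x) ^ Suc n / real (Suc n) - (x - x) ^ Suc n / real (Suc n)"
    by (rule integral_FTC_Icc_real[OF assms])
      (auto intro!: derivative_eq_intros simp del: of_nat_Suc power_Suc)
  then show ?thesis
    by (simp add: mult.commute)
qed

text \<open>The truncation lets the induction start: at \<open>n = 0\<close> the power is 1, even at
  \<open>x = t\<close>, and the indicator alone carries the cdf. The point \<open>t\<close> stays
  arbitrary because the step integrates the hypothesis over all of \<open>{a..t}\<close>.\<close>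

lemma (in real_distribution) iterated_cdf_eq_truncated_moment:
  assumes lower: "AE x in M. a \<le> x" and "a \<le> t"
  shows "iterated_cdf M a n t = (LINT x|M. indicator {a..t} x * (t - x) ^ n) / fact n"
  using \<open>a \<le> t\<close>
proof (induction n arbitrary: t)
  case 0
  have "cdf M t = measure M {a..t}"
    unfolding cdf_def by (rule finite_measure_eq_AE) (use lower in auto)
  then show ?case
    by simp
next
  case (Suc n)
  interpret P: pair_sigma_finite M lborel ..
  \<comment> \<open>Both ranges of integration become indicators, so that Fubini applies on the full
    product space. The support is the triangle \<open>a \<le> x \<le> s \<le> t\<close>.\<close>
  define f where
    "f x s = indicator {a..t} s * (indicator {a..s} x * (s - x) ^ n)" for x s :: real
  \<comment> \<open>The set \<open>{a..s}\<close> moves with \<open>s\<close>; as a condition on the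
    pair it is visibly measurable.\<close>
  have f_alt: "case_prod f = (\<lambda>p. indicator {a..t} (snd p) *
      ((if a \<le> fst p \<and> fst p \<le> snd p then 1 else 0) * (snd p - fst p) ^ n))"
    by (auto simp: f_def fun_eq_iff indicator_def)
  have meas: "case_prod f \<in> borel_measurable (M \<Otimes>\<^sub>M lborel)"
    unfolding f_alt by measurable
  \<comment> \<open>On the triangle \<open>0 \<le> s - x \<le> t - a\<close>. The bound is free of
    \<open>x\<close>, hence integrable: \<open>M\<close> is finite and \<open>{a..t}\<close> has
    finite length.\<close>
  have f_bound: "norm (f x s) \<le> indicator {a..t} s * (t - a) ^ n" for x s
    by (auto simp: f_def indicator_def abs_mult power_abs intro!: power_mono)
  have bound_int: "integrable (M \<Otimes>\<^sub>M lborel) (\<lambda>(x, s). indicator {a..t} s * (t - a) ^ n)"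
  proof (rule P.Fubini_integrable)
    show "(\<lambda>(x, s). indicator {a..t} s * (t - a) ^ n) \<in> borel_measurable (M \<Otimes>\<^sub>M lborel)"
      by measurable
  qed (auto intro!: integrable_mult_left integrable_real_indicator
      simp: emeasure_lborel_Icc_eq)
  have int: "integrable (M \<Otimes>\<^sub>M lborel) (case_prod f)"
    by (rule Bochner_Integration.integrable_bound[OF bound_int meas])
      (use f_bound Suc.prems in \<open>auto simp: abs_mult\<close>)
  \<comment> \<open>For fixed \<open>x\<close> in \<open>{a..t}\<close> the slice of the triangle is
    \<open>{x..t}\<close>; for any other \<open>x\<close> it is empty.\<close>
  have inner: "(LINT s|lborel. f x s)
      = indicator {a..t} x * ((t - x) ^ Suc n / real (Suc n))" for x
  proof (cases "x \<in> {a..t}")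
    case True
    then have "f x = (\<lambda>s. indicator {x..t} s * (s - x) ^ n)"
      by (auto simp: f_def fun_eq_iff indicator_def)
    with True show ?thesis
      using integral_shifted_power[of x t n] by simp
  next
    case False
    then have "f x = (\<lambda>s. 0)"
      by (auto simp: f_def fun_eq_iff indicator_def)
    with False show ?thesis
      by simp
  qed
  have "iterated_cdf M a (Suc n) t = (LBINT s:{a..t}. iterated_cdf M a n s)"
    using Suc.prems by (simp add: interval_integral_Icc)
  \<comment> \<open>The induction hypothesis requires \<open>a \<le> s\<close>; elsewhere the
    indicator makes both integrands 0.\<close>
  also have "\<dots> = (LINT s|lborel. (LINT x|M. f x s) / fact n)"
    unfolding set_lebesgue_integral_def
    by (rule Bochner_Integration.integral_cong)
      (auto simp: f_def Suc.IH indicator_def)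
  also have "\<dots> = (LINT x|M. (LINT s|lborel. f x s)) / fact n"
    by (simp add: P.Fubini_integral[OF int])
  also have "\<dots> = (LINT x|M. indicator {a..t} x * (t - x) ^ Suc n) / fact (Suc n)"
    unfolding inner by (simp add: field_simps del: of_nat_Suc)
  finally show ?case .
qed

theorem theorem1:
  fixes M :: "'a measure" and X :: "'a \<Rightarrow> real" and a b :: real and n :: nat
  assumes "a < b"
    and "prob_space M"
    and "X \<in> borel_measurable M"
    and "measure M {\<omega> \<in> space M. X \<omega> \<in> {a..b}} = 1"
  shows "primitive_seq (distr M borel X) a b n
           = 1 / fact n * (LINT \<omega>|M. (b - X \<omega>) ^ n)"
proof -
  interpret prob_space M
    by fact
  note [measurable] = assms(3)
  have supp: "AE \<omega> in M. X \<omega> \<in> {a..b}"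
    using AE_prob_1[OF assms(4)] by auto
  interpret D: real_distribution "distr M borel X"
    by (rule real_distribution_distr) fact
  have "AE x in distr M borel X. a \<le> x"
    using supp by (subst AE_distr_iff) auto
  then have "primitive_seq (distr M borel X) a b n
      = (LINT x|distr M borel X. indicator {a..b} x * (b - x) ^ n) / fact n"
    unfolding primitive_seq_def using assms(1)
    by (intro D.iterated_cdf_eq_truncated_moment) auto
  also have "\<dots> = (LINT \<omega>|M. indicator {a..b} (X \<omega>) * (b - X \<omega>) ^ n) / fact n"
    by (subst integral_distr) auto
  \<comment> \<open>Here the upper bound \<open>b\<close> on the support enters: the indicator is
    almost surely 1.\<close>
  also have "(LINT \<omega>|M. indicator {a..b} (X \<omega>) * (b - X \<omega>) ^ n) = (LINT \<omega>|M. (b - X \<omega>) ^ n)"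
    using supp by (intro integral_cong_AE) (auto simp: indicator_def)
  finally show ?thesis
    by simp
qed

end
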